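(* Assume (A1), (A2), (A3) of the context and let $x^*\in\mathcal L(F^0)$ be a stationary point of $F$. Then $x^*$ is a strict saddle point of $F$ if and only if $(x^*,\epsilon^* )$ with $\epsilon^*=0$ is an unstable fixed point of $T$. Moreover, if $\alpha<\beta/\rho$, then $DT(x^*,\epsilon^* )$ is invertible.
   Context: Let $f:\mathbb R^n\to\mathbb R$ be twice continuously differentiable, $\lambda>0$, $F(x)=f(x)+\lambda\sum_{i=1}^n r(|x_i|)$. (A1) $r:[0,\infty)\to\mathbb R$ is continuous and concave, $r(0)=0$, $C^2$ on $(0,\infty)$, $r'(t)\ge0$ for all $t>0$, and $r'(0^+):=\lim_{t\to0^+}r'(t)\in(0,\infty]$. (A2) Every $x$ with $0\in\partial F(x)$ satisfies $0\in\mathrm{rint}\,\partial F(x)$ ($\partial F$ the regular subdifferential, $\mathrm{rint}$ the relative interior). (A3) With $F(x,\epsilon)=f(x)+\lambda\sum_i r(|x_i|+\epsilon_i)$ and $F^0=F(x^0,\epsilon^0)$ for a given initial point, $\mathcal L(F^0)=\{x:F(x)\le F^0\}$ is bounded. $L_{\nabla f}$ is a Lipschitz constant of $\nabla f$ on $\mathcal L(F^0)$. $\mathcal I(x)=\{i:x_i\ne0\}$, $\mathcal J(x)=\{i:x_i=0\}$; $\nabla^2_{\mathcal I^*\mathcal I^*}F(x^* )$, with $\mathcal I^*=\mathcal I(x^* )$, is the Hessian of $F$ at $x^*$ with respect to the nonzero coordinates. A point $x^*$ is stationary if $\nabla_i f(x^* )=-\lambda\,\mathrm{sign}(x_i^*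 )r'(|x_i^*|)$ for $i\in\mathcal I(x^* )$ and $\nabla_i f(x^* )\in(-\lambda r'(0^+),\lambda r'(0^+))$ for $i\in\mathcal J(x^* )$. A stationary point $x^*$ is a strict saddle point if $d^T\nabla^2_{\mathcal I^*\mathcal I^*}F(x^* )d<0$ for some $d\in\mathbb R^{|\mathcal I^*|}$. The constant $\rho>0$ is such that $\|\nabla^2_{\mathcal I^*\mathcal I^*}F(x^* )\|\le\rho$ (spectral norm) for every stationary point $x^*\in\mathcal L(F^0)$. Let $\alpha,\mu\in(0,1)$, $\beta>0$, $\beta>\alpha L_{\nabla f}/2$. For $x\in\mathbb R^n$, $\epsilon\in\mathbb R^n_+$ let $w_i=r'(|x_i|+\epsilon_i)$ (with $w_i=r'(0^+)$ if $|x_i|+\epsilon_i=0$), $v=x-\frac1\beta\nabla f(x)$, $S^x_i(x,\epsilon)=\mathrm{sign}(v_i)\max(|v_i|-\lambda w_i/\beta,0)$ (equal to $0$ if $w_i=+\infty$), and $T(x,\epsilon)=((1-\alpha)x+\alpha S^x(x,\epsilon),\,(1-\alpha(1-\mu))\epsilon)$. $DT$ is the Jacobian of $T$, with derivatives taken within the domain $\mathbb R^n\times\mathbb R^n_+$ ($T$ is $C^1$ near $(x^*,0)$ in this sense for every stationary $x^*$). A fixed point of $T$ is unstable if $DT$ at that point has at least one eigenvalue of magnitude strictly larger than $1$.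
   Formalization: When F(x* ) = F^0, the formal theorem additionally assumes that L_{∇f} is a Lipschitz constant of ∇f on a neighbourhood of x*; with L_{∇f} valid only on L(F^0) the equivalence can fail there (e.g. when L(F^0) is a single point). *)

theory Defs
  imports "HOL-Analysis.Analysis"
begin

section \<open>Calculus on \<open>real ^ 'n\<close>\<close>

definition grad :: "(real ^ 'n \<Rightarrow> real) \<Rightarrow> real ^ 'n \<Rightarrow> real ^ 'n" where
  "grad f x = (THE D. GDERIV f x :> D)"

definition twice_cont_differentiable :: "(real ^ 'n \<Rightarrow> real) \<Rightarrow> bool" where
  "twice_cont_differentiable f \<longleftrightarrow>
     (\<exists>g H. (\<forall>x. GDERIV f x :> g x) \<and>
            (\<forall>x. (g has_derivative (\<lambda>h. H x *v h)) (at x)) \<and>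
            continuous_on UNIV (H :: real ^ 'n \<Rightarrow> real ^ 'n ^ 'n))"

definition partial_deriv :: "'n \<Rightarrow> (real ^ 'n \<Rightarrow> real) \<Rightarrow> real ^ 'n \<Rightarrow> real" where
  "partial_deriv i g x = deriv (\<lambda>t. g (x + t *\<^sub>R axis i 1)) 0"

text \<open>
  The Hessian of \<open>g\<close> at \<open>x\<close> with respect to the nonzero coordinates of \<open>x\<close>. The
  submatrix with rows and columns in \<open>{i. x $ i \<noteq> 0}\<close> is kept inside an
  \<open>'n \<times> 'n\<close> matrix by padding with zeros; this changes neither its operator norm nor its
  quadratic form on vectors supported on these coordinates. The entries in the block use
  \<open>g\<close> only on translates of \<open>x\<close> along nonzero coordinates.
\<close>
definition hessian_nonzero :: "(real ^ 'n \<Rightarrow> real) \<Rightarrow> real ^ 'n \<Rightarrow> real ^ 'n ^ 'n" where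
  "hessian_nonzero g x =
     (\<chi> i j. if x $ i \<noteq> 0 \<and> x $ j \<noteq> 0 then partial_deriv i (partial_deriv j g) x else 0)"

definition spectral_norm :: "real ^ 'n ^ 'm \<Rightarrow> real" where
  "spectral_norm A = onorm (\<lambda>v. A *v v)"

definition regular_subdifferential :: "('a::real_inner \<Rightarrow> real) \<Rightarrow> 'a \<Rightarrow> 'a set" where
  "regular_subdifferential F x =
     {v. 0 \<le> Liminf (at x) (\<lambda>y. ereal ((F y - F x - v \<bullet> (y - x)) / norm (y - x)))}"

section \<open>The regularizer and the objective\<close>

text \<open>The one-sided limit \<open>r'(0+)\<close>, possibly infinite.\<close>
definition deriv_at_0 :: "(real \<Rightarrow> real) \<Rightarrow> ereal" where
  "deriv_at_0 r = Lim (at_right 0) (\<lambda>t. ereal (deriv r t))"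

text \<open>Only the values of \<open>r\<close> on \<open>{0..}\<close> matter.\<close>
definition A1 :: "(real \<Rightarrow> real) \<Rightarrow> bool" where
  "A1 r \<longleftrightarrow>
     continuous_on {0..} r \<and> concave_on {0..} r \<and> r 0 = 0 \<and>
     (\<forall>t>0. r differentiable (at t)) \<and>
     (\<forall>t>0. deriv r differentiable (at t)) \<and>
     continuous_on {0<..} (deriv (deriv r)) \<and>
     (\<forall>t>0. 0 \<le> deriv r t) \<and>
     (\<exists>l>0. ((\<lambda>t. ereal (deriv r t)) \<longlongrightarrow> l) (at_right 0))"

definition objective :: "(real ^ 'n \<Rightarrow> real) \<Rightarrow> real \<Rightarrow> (real \<Rightarrow> real) \<Rightarrow> real ^ 'n \<Rightarrow> real" where
  "objective f lam r x = f x + lam * (\<Sum>i\<in>UNIV. r \<bar>x $ i\<bar>)"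

definition objective_eps ::
  "(real ^ 'n \<Rightarrow> real) \<Rightarrow> real \<Rightarrow> (real \<Rightarrow> real) \<Rightarrow> real ^ 'n \<Rightarrow> real ^ 'n \<Rightarrow> real" where
  "objective_eps f lam r x eps = f x + lam * (\<Sum>i\<in>UNIV. r (\<bar>x $ i\<bar> + eps $ i))"

definition sublevel :: "('a \<Rightarrow> real) \<Rightarrow> real \<Rightarrow> 'a set" where
  "sublevel F c = {x. F x \<le> c}"

definition A2 :: "(real ^ 'n \<Rightarrow> real) \<Rightarrow> bool" where
  "A2 F \<longleftrightarrow> (\<forall>x. 0 \<in> regular_subdifferential F x \<longrightarrow>
                    0 \<in> rel_interior (regular_subdifferential F x))"

definition A3 :: "(real ^ 'n \<Rightarrow> real) \<Rightarrow> real \<Rightarrow> bool" where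
  "A3 F F0 \<longleftrightarrow> bounded (sublevel F F0)"

definition stationary ::
  "(real ^ 'n \<Rightarrow> real) \<Rightarrow> real \<Rightarrow> (real \<Rightarrow> real) \<Rightarrow> real ^ 'n \<Rightarrow> bool" where
  "stationary f lam r x \<longleftrightarrow>
     (\<forall>i. x $ i \<noteq> 0 \<longrightarrow> grad f x $ i = - lam * sgn (x $ i) * deriv r \<bar>x $ i\<bar>) \<and>
     (\<forall>i. x $ i = 0 \<longrightarrow>
        - (ereal lam * deriv_at_0 r) < ereal (grad f x $ i) \<and>
        ereal (grad f x $ i) < ereal lam * deriv_at_0 r)"

definition strict_saddle ::
  "(real ^ 'n \<Rightarrow> real) \<Rightarrow> real \<Rightarrow> (real \<Rightarrow> real) \<Rightarrow> real ^ 'n \<Rightarrow> bool" where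
  "strict_saddle f lam r x \<longleftrightarrow>
     stationary f lam r x \<and>
     (\<exists>d. (\<forall>i. x $ i = 0 \<longrightarrow> d $ i = 0) \<and>
          d \<bullet> (hessian_nonzero (objective f lam r) x *v d) < 0)"

section \<open>The iteration map\<close>

definition weight :: "(real \<Rightarrow> real) \<Rightarrow> real ^ 'n \<Rightarrow> real ^ 'n \<Rightarrow> 'n \<Rightarrow> ereal" where
  "weight r x eps i =
     (if \<bar>x $ i\<bar> + eps $ i = 0 then deriv_at_0 r else ereal (deriv r (\<bar>x $ i\<bar> + eps $ i)))"

definition Sx ::
  "(real ^ 'n \<Rightarrow> real) \<Rightarrow> real \<Rightarrow> (real \<Rightarrow> real) \<Rightarrow> real \<Rightarrow> real ^ 'n \<Rightarrow> real ^ 'n \<Rightarrow> real ^ 'n" where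
  "Sx f lam r beta x eps =
     (let v = x - (1 / beta) *\<^sub>R grad f x
      in \<chi> i. if weight r x eps i = \<infinity> then 0
             else sgn (v $ i) *
                  max (\<bar>v $ i\<bar> - lam * real_of_ereal (weight r x eps i) / beta) 0)"

definition T_map ::
  "(real ^ 'n \<Rightarrow> real) \<Rightarrow> real \<Rightarrow> (real \<Rightarrow> real) \<Rightarrow> real \<Rightarrow> real \<Rightarrow> real \<Rightarrow>
   (real ^ 'n) \<times> (real ^ 'n) \<Rightarrow> (real ^ 'n) \<times> (real ^ 'n)" where
  "T_map f lam r alpha beta mu =
     (\<lambda>(x, eps). ((1 - alpha) *\<^sub>R x + alpha *\<^sub>R Sx f lam r beta x eps,
                  (1 - alpha * (1 - mu)) *\<^sub>R eps))"

definition T_domain :: "((real ^ 'n) \<times> (real ^ 'n)) set" where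
  "T_domain = {(x, eps). \<forall>i. 0 \<le> eps $ i}"

section \<open>Jacobians and unstable fixed points\<close>

text \<open>
  Pairs of vectors are identified with vectors indexed by the sum type, so that the derivative of
  a self-map of \<open>(real ^ 'n) \<times> (real ^ 'm)\<close> is a square matrix.
\<close>
definition stack :: "(real ^ 'n) \<times> (real ^ 'm) \<Rightarrow> real ^ ('n + 'm)" where
  "stack z = (\<chi> k. case k of Inl i \<Rightarrow> fst z $ i | Inr j \<Rightarrow> snd z $ j)"

definition unstack :: "real ^ ('n + 'm) \<Rightarrow> (real ^ 'n) \<times> (real ^ 'm)" where
  "unstack u = (\<chi> i. u $ Inl i, \<chi> j. u $ Inr j)"

definition jacobian_within ::
  "((real ^ 'n) \<times> (real ^ 'm) \<Rightarrow> (real ^ 'n) \<times> (real ^ 'm)) \<Rightarrow> ((real ^ 'n) \<times> (real ^ 'm)) set \<Rightarrow>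
   (real ^ 'n) \<times> (real ^ 'm) \<Rightarrow> real ^ ('n + 'm) ^ ('n + 'm)" where
  "jacobian_within T D z =
     jacobian (\<lambda>u. stack (T (unstack u))) (at (stack z) within stack ` D)"

text \<open>Eigenvalues of a real matrix are taken over the complex numbers.\<close>
definition complex_eigenvalue :: "real ^ 'k ^ 'k \<Rightarrow> complex \<Rightarrow> bool" where
  "complex_eigenvalue A z \<longleftrightarrow>
     (\<exists>v :: complex ^ 'k. v \<noteq> 0 \<and> map_matrix complex_of_real A *v v = z *s v)"

definition unstable_fixed_point ::
  "((real ^ 'n) \<times> (real ^ 'm) \<Rightarrow> (real ^ 'n) \<times> (real ^ 'm)) \<Rightarrow> ((real ^ 'n) \<times> (real ^ 'm)) set \<Rightarrow>
   (real ^ 'n) \<times> (real ^ 'm) \<Rightarrow> bool" where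
  "unstable_fixed_point T D z \<longleftrightarrow>
     T z = z \<and> (\<exists>e. complex_eigenvalue (jacobian_within T D z) e \<and> 1 < cmod e)"

end

theory Submission
  imports Defs
begin

text \<open>
  At \<open>(x*, 0)\<close> the Jacobian of \<open>T\<close> is block triangular. The zero coordinates of \<open>x*\<close>, on which
  soft thresholding is locally constant zero, contribute the eigenvalue \<open>1 - \<alpha>\<close>, the
  \<open>\<epsilon>\<close>-coordinates contribute \<open>1 - \<alpha> (1 - \<mu>)\<close>, and the nonzero coordinates contribute the block
  \<open>I - (\<alpha> / \<beta>) P\<close>, where \<open>P\<close> is the reduced Hessian of \<open>F\<close>. As \<open>P\<close> is symmetric, an eigenvalue
  of modulus greater than \<open>1\<close> must be \<open>1 - (\<alpha> / \<beta>) k\<close> with a real eigenvalue \<open>k\<close> of \<open>P\<close> such that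
  \<open>k < 0\<close> or \<open>k > 2 \<beta> / \<alpha>\<close>. The latter is impossible since \<open>k \<le> L\<close>: the concave regularizer only
  decreases the Hessian of \<open>f\<close>. Finally, \<open>k \<le> \<rho> < \<beta> / \<alpha>\<close> rules out the eigenvalue \<open>0\<close>.
\<close>

section \<open>Symmetry of the second derivative\<close>

text \<open>Two applications of the mean value theorem: along \<open>u\<close> to the increment of
  \<open>f\<close> in direction \<open>v\<close>, then along \<open>v\<close> to the directional
  derivative \<open>u \<bullet> g\<close>. The left-hand side is symmetric in \<open>u\<close> and
  \<open>v\<close> while the right-hand side is not visibly so, which is what the symmetry proof
  exploits.\<close>

lemma second_difference_mean_value:
  fixes f :: "real ^ 'n \<Rightarrow> real" and H :: "real ^ 'n \<Rightarrow> real ^ 'n ^ 'n"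
  assumes g: "\<And>x. GDERIV f x :> g x"
    and H: "\<And>x. (g has_derivative (\<lambda>h. H x *v h)) (at x)"
    and "0 < t"
  shows "\<exists>z w. 0 < z \<and> z < t \<and> 0 < w \<and> w < t \<and>
           f (x + t *\<^sub>R u + t *\<^sub>R v) - f (x + t *\<^sub>R u) - f (x + t *\<^sub>R v) + f x =
           t\<^sup>2 * (u \<bullet> (H (x + z *\<^sub>R u + w *\<^sub>R v) *v v))"
proof -
  have fd: "(f has_derivative (\<lambda>h. h \<bullet> g y)) (at y)" for y
    using g by (simp add: gderiv_def)
  have der: "((\<lambda>s. f (x + s *\<^sub>R u + t *\<^sub>R v) - f (x + s *\<^sub>R u)) has_real_derivative
      u \<bullet> (g (x + s *\<^sub>R u + t *\<^sub>R v) - g (x + s *\<^sub>R u))) (at s)" for s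
    unfolding has_field_derivative_def
    by (rule derivative_eq_intros has_derivative_compose[OF _ fd] refl | simp add: algebra_simps fun_eq_iff)+
  obtain z where z: "0 < z" "z < t"
    and eq1: "(f (x + t *\<^sub>R u + t *\<^sub>R v) - f (x + t *\<^sub>R u)) - (f (x + 0 *\<^sub>R u + t *\<^sub>R v) - f (x + 0 *\<^sub>R u)) =
      (t - 0) * (u \<bullet> (g (x + z *\<^sub>R u + t *\<^sub>R v) - g (x + z *\<^sub>R u)))"
    using MVT2[OF \<open>0 < t\<close> der] by blast
  have der2: "((\<lambda>s. u \<bullet> g (x + z *\<^sub>R u + s *\<^sub>R v)) has_real_derivative
      u \<bullet> (H (x + z *\<^sub>R u + s *\<^sub>R v) *v v)) (at s)" for s
    unfolding has_field_derivative_def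
    by (rule derivative_eq_intros has_derivative_compose[OF _ H] refl
        | simp add: matrix_vector_mult_scaleR fun_eq_iff)+
  obtain w where w: "0 < w" "w < t"
    and eq2: "u \<bullet> g (x + z *\<^sub>R u + t *\<^sub>R v) - u \<bullet> g (x + z *\<^sub>R u + 0 *\<^sub>R v) =
      (t - 0) * (u \<bullet> (H (x + z *\<^sub>R u + w *\<^sub>R v) *v v))"
    using MVT2[OF \<open>0 < t\<close> der2] by blast
  show ?thesis
    using z w eq1 eq2 by (intro exI[of _ z] exI[of _ w]) (auto simp: inner_diff_right power2_eq_square)
qed

text \<open>Schwarz's theorem. Expanding the same second difference in both orders equates
  \<open>u \<bullet> (H y *v v)\<close> and \<open>v \<bullet> (H y' *v u)\<close> at two points
  close to \<open>x\<close>; continuity of \<open>H\<close> moves both points to \<open>x\<close> up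
  to an arbitrary error.\<close>

lemma second_derivative_symmetric:
  fixes f :: "real ^ 'n \<Rightarrow> real" and H :: "real ^ 'n \<Rightarrow> real ^ 'n ^ 'n"
  assumes g: "\<And>x. GDERIV f x :> g x"
    and H: "\<And>x. (g has_derivative (\<lambda>h. H x *v h)) (at x)"
    and cont: "continuous_on UNIV H"
  shows "u \<bullet> (H x *v v) = v \<bullet> (H x *v u)"
proof -
  have near: "\<exists>d>0. \<forall>y. dist y x < d \<longrightarrow> \<bar>a \<bullet> (H y *v b) - a \<bullet> (H x *v b)\<bar> < e" if "e > 0" for a b e
  proof -
    have "isCont (\<lambda>y. a \<bullet> (H y *v b)) x"
      using cont by (intro continuous_intros continuous_on_interior[of UNIV])
        (auto simp: matrix_vector_mult_def intro!: continuous_intros)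
    then show ?thesis
      using \<open>e > 0\<close> unfolding continuous_at_eps_delta by (auto simp: dist_real_def)
  qed
  have "\<bar>u \<bullet> (H x *v v) - v \<bullet> (H x *v u)\<bar> \<le> e" if "e > 0" for e
  proof -
    obtain d1 where d1: "d1 > 0" "\<And>y. dist y x < d1 \<Longrightarrow> \<bar>u \<bullet> (H y *v v) - u \<bullet> (H x *v v)\<bar> < e / 2"
      using near[of "e/2" u v] \<open>e > 0\<close> by auto
    obtain d2 where d2: "d2 > 0" "\<And>y. dist y x < d2 \<Longrightarrow> \<bar>v \<bullet> (H y *v u) - v \<bullet> (H x *v u)\<bar> < e / 2"
      using near[of "e/2" v u] \<open>e > 0\<close> by auto
    \<comment> \<open>The intermediate points lie within \<open>t * (norm u + norm v)\<close> of
      \<open>x\<close>. The summand 1 keeps the denominator positive when \<open>u = v = 0\<close>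
      and makes the bound strict.\<close>
    define t where "t = min d1 d2 / (norm u + norm v + 1)"
    have pos: "norm u + norm v + 1 > 0" by (simp add: add_nonneg_pos)
    have t: "t > 0" using d1(1) d2(1) pos by (simp add: t_def)
    have tb: "t * (norm u + norm v) < min d1 d2"
    proof -
      have "t * (norm u + norm v) < t * (norm u + norm v + 1)" using t by simp
      also have "\<dots> = min d1 d2" using pos by (simp add: t_def)
      finally show ?thesis .
    qed
    have small: "dist (x + z *\<^sub>R a + w *\<^sub>R b) x < min d1 d2"
      if "0 < z" "z < t" "0 < w" "w < t" "norm a + norm b = norm u + norm v" for z w a b
    proof -
      have "dist (x + z *\<^sub>R a + w *\<^sub>R b) x = norm (z *\<^sub>R a + w *\<^sub>R b)"
        by (simp add: dist_norm)
      also have "\<dots> \<le> z * norm a + w * norm b"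
        using that norm_triangle_ineq[of "z *\<^sub>R a" "w *\<^sub>R b"] by simp
      also have "\<dots> \<le> t * norm a + t * norm b"
        using that by (intro add_mono mult_right_mono) auto
      also have "\<dots> = t * (norm u + norm v)"
        using that(5) by (simp flip: distrib_left)
      finally show ?thesis using tb by linarith
    qed
    obtain z w where zw: "0 < z" "z < t" "0 < w" "w < t" and
      1: "f (x + t *\<^sub>R u + t *\<^sub>R v) - f (x + t *\<^sub>R u) - f (x + t *\<^sub>R v) + f x =
           t\<^sup>2 * (u \<bullet> (H (x + z *\<^sub>R u + w *\<^sub>R v) *v v))"
      using second_difference_mean_value[OF g H t, of x u v] by blast
    obtain z' w' where zw': "0 < z'" "z' < t" "0 < w'" "w' < t" and
      2: "f (x + t *\<^sub>R v + t *\<^sub>R u) - f (x + t *\<^sub>R v) - f (x + t *\<^sub>R u) + f x =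
           t\<^sup>2 * (v \<bullet> (H (x + z' *\<^sub>R v + w' *\<^sub>R u) *v u))"
      using second_difference_mean_value[OF g H t, of x v u] by blast
    have "t\<^sup>2 * (u \<bullet> (H (x + z *\<^sub>R u + w *\<^sub>R v) *v v)) =
        t\<^sup>2 * (v \<bullet> (H (x + z' *\<^sub>R v + w' *\<^sub>R u) *v u))"
      using 1 2 by (simp only: add.assoc add.commute[of "t *\<^sub>R v" "t *\<^sub>R u"])
    then have eq: "u \<bullet> (H (x + z *\<^sub>R u + w *\<^sub>R v) *v v) = v \<bullet> (H (x + z' *\<^sub>R v + w' *\<^sub>R u) *v u)"
      using t by simp
    have "\<bar>u \<bullet> (H (x + z *\<^sub>R u + w *\<^sub>R v) *v v) - u \<bullet> (H x *v v)\<bar> < e / 2"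
      using small[of z w u v] zw by (intro d1) auto
    moreover have "\<bar>v \<bullet> (H (x + z' *\<^sub>R v + w' *\<^sub>R u) *v u) - v \<bullet> (H x *v u)\<bar> < e / 2"
      using small[of z' w' v u] zw' by (intro d2) auto
    ultimately show ?thesis using eq by linarith
  qed
  then have "\<bar>u \<bullet> (H x *v v) - v \<bullet> (H x *v u)\<bar> \<le> 0"
    by (rule field_le_epsilon[where y = 0, simplified])
  then show ?thesis by simp
qed

section \<open>Eigenvalues of real matrices\<close>

text \<open>
  A minimizer \<open>e\<close> of the quadratic form on the unit sphere, with minimal value \<open>k\<close>, is an
  eigenvector: \<open>\<phi> w = w \<bullet> (A *v w) - k * (w \<bullet> w)\<close> is nonnegative and vanishes at \<open>e\<close>, and so
  does its derivative.
\<close>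
lemma symmetric_matrix_negative_eigenvalue:
  fixes A :: "real ^ 'n ^ 'n"
  assumes sym: "\<And>u v. u \<bullet> (A *v v) = v \<bullet> (A *v u)"
    and neg: "d \<bullet> (A *v d) < 0"
  shows "\<exists>k e. k < 0 \<and> e \<noteq> 0 \<and> A *v e = k *\<^sub>R e"
proof -
  let ?q = "\<lambda>v. v \<bullet> (A *v v)"
  have d0: "d \<noteq> 0" using neg by auto
  have "continuous_on (sphere 0 1) ?q"
    by (intro continuous_intros matrix_vector_mult_linear_continuous_on)
  moreover have ns: "(1 / norm d) *\<^sub>R d \<in> sphere 0 1" using d0 by simp
  ultimately obtain e where e: "e \<in> sphere 0 1" and emin: "\<And>v. v \<in> sphere 0 1 \<Longrightarrow> ?q e \<le> ?q v"
    using continuous_attains_inf[of "sphere (0 :: real ^ 'n) 1" ?q] by (metis compact_sphere empty_iff)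
  define k where "k = ?q e"
  have "k \<le> ?q ((1 / norm d) *\<^sub>R d)" unfolding k_def by (rule emin[OF ns])
  also have "\<dots> < 0" using neg d0 by (simp add: matrix_vector_mult_scaleR divide_neg_pos)
  finally have k: "k < 0" .
  define \<phi> where "\<phi> w = ?q w - k * (w \<bullet> w)" for w
  have \<phi>: "\<phi> w \<ge> 0" for w
  proof (cases "w = 0")
    case False
    then have "k \<le> ?q ((1 / norm w) *\<^sub>R w)" unfolding k_def by (intro emin) simp
    also have "\<dots> = ?q w / (w \<bullet> w)"
      by (simp add: matrix_vector_mult_scaleR dot_square_norm power2_eq_square)
    finally show ?thesis using False by (simp add: \<phi>_def pos_le_divide_eq)
  qed (simp add: \<phi>_def)
  define u where "u = A *v e - k *\<^sub>R e"
  have ee: "e \<bullet> e = 1" using e by (simp add: dot_square_norm)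
  \<comment> \<open>This is the exact Taylor expansion of the quadratic \<phi> along the residual
    \<open>u\<close>: the constant term is \<open>\<phi> e = 0\<close>, and the gradient of \<phi>
    at \<open>e\<close> is \<open>2 u\<close>.\<close>
  have expand: "\<phi> (e + t *\<^sub>R u) = 2 * t * (u \<bullet> u) + t\<^sup>2 * \<phi> u" for t
  proof -
    have eu: "e \<bullet> (A *v u) = u \<bullet> (A *v e)" by (rule sym)
    have uu: "u \<bullet> (A *v e) = u \<bullet> u + k * (u \<bullet> e)"
      by (subst (3) u_def) (simp add: inner_diff_right)
    have ke: "e \<bullet> (A *v e) = k" by (simp add: k_def)
    show ?thesis unfolding \<phi>_def
      by (simp add: matrix_vector_right_distrib matrix_vector_mult_scaleR inner_add_left inner_add_right
          eu uu ke ee inner_commute[of e u] power2_eq_square algebra_simps)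
  qed
  have "u \<bullet> u = 0"
  proof (rule ccontr)
    assume "u \<bullet> u \<noteq> 0"
    then have up: "u \<bullet> u > 0" by simp
    \<comment> \<open>A descent step against the gradient. The 1 in the denominator covers the case
      \<open>\<phi> u = 0\<close>, and the choice turns the factor
      \<open>2 * (u \<bullet> u) + t * \<phi> u\<close> into \<open>u \<bullet> u - t\<close>, which
      is positive.\<close>
    define t where "t = - (u \<bullet> u) / (\<phi> u + 1)"
    have pp: "\<phi> u + 1 > 0" using \<phi>[of u] by simp
    have tneg: "t < 0" using up pp by (simp add: t_def divide_neg_pos)
    have "t * (\<phi> u + 1) = - (u \<bullet> u)" using pp by (simp add: t_def)
    then have "2 * (u \<bullet> u) + t * \<phi> u = (u \<bullet> u) - t" by (simp add: algebra_simps)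
    then have "2 * (u \<bullet> u) + t * \<phi> u > 0" using up tneg by linarith
    then have "t * (2 * (u \<bullet> u) + t * \<phi> u) < 0" using tneg by (simp add: mult_neg_pos)
    then have "\<phi> (e + t *\<^sub>R u) < 0"
      unfolding expand by (simp add: algebra_simps power2_eq_square)
    then show False using \<phi> by (simp add: not_less[symmetric])
  qed
  then have "A *v e = k *\<^sub>R e" by (simp add: u_def)
  moreover have "e \<noteq> 0" using e by auto
  ultimately show ?thesis using k by blast
qed

text \<open>Writing the eigenvector as \<open>a + i b\<close> and separating real and imaginary
  parts leaves only real vectors, so that the symmetry of the real Hessian can be used with the real
  inner product.\<close>

lemma complex_eigenvalue_components:
  fixes A :: "real ^ 'k ^ 'k"
  shows "complex_eigenvalue A z \<longleftrightarrow>
    (\<exists>a b. (a \<noteq> 0 \<or> b \<noteq> 0) \<and> A *v a = Re z *\<^sub>R a - Im z *\<^sub>R b \<and> A *v b = Re z *\<^sub>R b + Im z *\<^sub>R a)"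
proof
  assume "complex_eigenvalue A z"
  then obtain v :: "complex ^ 'k" where v: "v \<noteq> 0" and eq: "map_matrix complex_of_real A *v v = z *s v"
    by (auto simp: complex_eigenvalue_def)
  let ?a = "\<chi> i. Re (v $ i)" and ?b = "\<chi> i. Im (v $ i)"
  have row: "(\<Sum>j\<in>UNIV. complex_of_real (A $ i $ j) * v $ j) = z * v $ i" for i
    using arg_cong[OF eq, of "\<lambda>w. w $ i"] by (simp add: matrix_vector_mult_def map_matrix_def)
  have "?a \<noteq> 0 \<or> ?b \<noteq> 0"
    using v by (auto simp: vec_eq_iff complex_eq_iff)
  moreover have "A *v ?a = Re z *\<^sub>R ?a - Im z *\<^sub>R ?b"
    using arg_cong[OF row, of Re] by (simp add: vec_eq_iff matrix_vector_mult_def)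
  moreover have "A *v ?b = Re z *\<^sub>R ?b + Im z *\<^sub>R ?a"
    using arg_cong[OF row, of Im] by (simp add: vec_eq_iff matrix_vector_mult_def algebra_simps)
  ultimately show "\<exists>a b. (a \<noteq> 0 \<or> b \<noteq> 0) \<and> A *v a = Re z *\<^sub>R a - Im z *\<^sub>R b \<and> A *v b = Re z *\<^sub>R b + Im z *\<^sub>R a"
    by blast
next
  assume "\<exists>a b. (a \<noteq> 0 \<or> b \<noteq> 0) \<and> A *v a = Re z *\<^sub>R a - Im z *\<^sub>R b \<and> A *v b = Re z *\<^sub>R b + Im z *\<^sub>R a"
  then obtain a b where "a \<noteq> 0 \<or> b \<noteq> 0"
    and ab: "A *v a = Re z *\<^sub>R a - Im z *\<^sub>R b" "A *v b = Re z *\<^sub>R b + Im z *\<^sub>R a"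
    by blast
  then have "(\<chi> i. Complex (a $ i) (b $ i)) \<noteq> 0"
    by (auto simp: vec_eq_iff complex_eq_iff)
  moreover have "map_matrix complex_of_real A *v (\<chi> i. Complex (a $ i) (b $ i)) =
      z *s (\<chi> i. Complex (a $ i) (b $ i))"
    using ab by (simp add: vec_eq_iff matrix_vector_mult_def map_matrix_def complex_eq_iff algebra_simps)
  ultimately show "complex_eigenvalue A z"
    unfolding complex_eigenvalue_def by blast
qed

section \<open>Derivative bounds from Lipschitz continuity and concavity\<close>

text \<open>Comparing \<open>g (x + t h) - g x\<close> with its linearization for small
  \<open>t > 0\<close> gives the bound with \<open>L + e\<close> in place of \<open>L\<close>.
  Openness of \<open>U\<close> ensures that \<open>x + t h\<close> stays in \<open>U\<close> for
  every direction \<open>h\<close>.\<close>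

lemma has_derivative_lipschitz_bound:
  fixes g :: "'a::real_normed_vector \<Rightarrow> 'b::real_normed_vector"
  assumes der: "(g has_derivative g') (at x)"
    and "open U" "x \<in> U" "L-lipschitz_on U g"
  shows "norm (g' h) \<le> L * norm h"
proof -
  interpret bounded_linear g' using der by (rule has_derivative_bounded_linear)
  have "norm (g' h) \<le> (L + e) * norm h" if "e > 0" "h \<noteq> 0" for e
  proof -
    obtain d where d: "d > 0"
      "\<And>y. norm (y - x) < d \<Longrightarrow> norm (g y - g x - g' (y - x)) \<le> e * norm (y - x)"
      using der \<open>e > 0\<close> unfolding has_derivative_at_alt by blast
    obtain d' where d': "d' > 0" "ball x d' \<subseteq> U"
      using \<open>open U\<close> \<open>x \<in> U\<close> open_contains_ball by blast
    define t where "t = min d d' / (2 * norm h)"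
    have t: "t > 0" using d d' \<open>h \<noteq> 0\<close> by (simp add: t_def)
    have th: "norm (t *\<^sub>R h) < min d d'"
      using d(1) d'(1) \<open>h \<noteq> 0\<close> by (simp add: t_def) linarith
    let ?y = "x + t *\<^sub>R h"
    have "?y \<in> U" using th d'(2) by (auto simp: dist_norm)
    then have "norm (g ?y - g x) \<le> L * norm (t *\<^sub>R h)"
      using lipschitz_onD[OF \<open>L-lipschitz_on U g\<close> _ \<open>x \<in> U\<close>, of ?y] by (simp add: dist_norm)
    moreover have "norm (g ?y - g x - g' (t *\<^sub>R h)) \<le> e * norm (t *\<^sub>R h)"
      using d(2)[of ?y] th by simp
    ultimately have "norm (g' (t *\<^sub>R h)) \<le> L * norm (t *\<^sub>R h) + e * norm (t *\<^sub>R h)"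
      using norm_triangle_ineq4[of "g ?y - g x" "g ?y - g x - g' (t *\<^sub>R h)"] by simp
    then have "t * norm (g' h) \<le> t * ((L + e) * norm h)"
      using t by (simp add: scaleR algebra_simps)
    then show ?thesis using t by simp
  qed
  \<comment> \<open>Using the previous bound with \<open>e / norm h\<close> turns the relative error
    into an additive one, which can be sent to 0.\<close>
  then have "norm (g' h) \<le> L * norm h + e" if "e > 0" "h \<noteq> 0" for e
    using that(2) divide_pos_pos[OF that(1), of "norm h"]
    by (force simp: algebra_simps)
  then show ?thesis
    by (cases "h = 0") (auto intro: field_le_epsilon simp: zero)
qed

text \<open>A positive \<open>D\<close> would make \<open>deriv r\<close> increase strictly just to
  the right of \<open>t\<close>, whereas the tangent lines of a concave function lie above its graph
  and force \<open>deriv r\<close> to be nonincreasing.\<close>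

lemma concave_deriv2_nonpos:
  assumes "concave_on {0<..} r"
    and r: "\<And>t. 0 < t \<Longrightarrow> r differentiable (at t)"
    and r': "(deriv r has_real_derivative D) (at t)" and "0 < t"
  shows "D \<le> 0"
proof (rule ccontr)
  assume "\<not> D \<le> 0"
  have d: "(r has_real_derivative deriv r s) (at s)" if "s > 0" for s
    using r[OF that] by (simp add: DERIV_deriv_iff_real_differentiable)
  have tangent: "r y \<le> r s + deriv r s * (y - s)" if "s > 0" "y > 0" for s y
  proof -
    have "convex_on {0<..} (\<lambda>y. - r y)"
      using assms(1) by (simp add: concave_on_def)
    moreover have "((\<lambda>y. - r y) has_real_derivative - deriv r s) (at s within {0<..})"
      using DERIV_minus[OF d[OF that(1)]] by (rule has_field_derivative_at_within)
    ultimately have "- r y - (- r s) \<ge> - deriv r s * (y - s)"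
      using that by (intro convex_on_imp_above_tangent[of "{0<..}"]) (simp_all add: interior_open)
    then show ?thesis by simp
  qed
  obtain e where e: "e > 0" "\<And>h. 0 < h \<Longrightarrow> h < e \<Longrightarrow> deriv r t < deriv r (t + h)"
    using DERIV_pos_inc_right[OF r'] \<open>\<not> D \<le> 0\<close> by (metis not_le)
  define s where "s = t + e / 2"
  have "deriv r t < deriv r s" "s > t" "s > 0" using e \<open>0 < t\<close> by (auto simp: s_def)
  \<comment> \<open>This is the sum of the tangent inequalities at \<open>t\<close> and at
    \<open>s\<close>; the values of \<open>r\<close> cancel.\<close>
  moreover have "0 \<le> (deriv r t - deriv r s) * (s - t)"
    using tangent[of t s] tangent[of s t] \<open>s > 0\<close> \<open>0 < t\<close> by (simp add: algebra_simps)
  ultimately show False by (simp add: zero_le_mult_iff)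
qed

section \<open>Gradient and reduced Hessian of the objective\<close>

lemma grad_eqI: "GDERIV f x :> D \<Longrightarrow> grad f x = D"
  unfolding grad_def
proof (rule the_equality)
  fix D' assume "GDERIV f x :> D" "GDERIV f x :> D'"
  then have "(\<lambda>h. h \<bullet> D') = (\<lambda>h. h \<bullet> D)"
    unfolding gderiv_def by (rule has_derivative_unique[rotated])
  then have "(D' - D) \<bullet> (D' - D) = 0"
    by (metis inner_diff_right cancel_comm_monoid_add_class.diff_cancel)
  then show "D' = D" by simp
qed

lemma eventually_sgn_eq:
  fixes s :: real
  assumes "s \<noteq> 0"
  shows "\<forall>\<^sub>F y in nhds s. sgn y = sgn s"
proof (cases "s > 0")
  case True
  then have "\<forall>\<^sub>F y in nhds s. y > 0" by (intro eventually_nhds_in_open[of "{0<..}", simplified]) auto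
  then show ?thesis by eventually_elim (use True in simp)
next
  case False
  then have "\<forall>\<^sub>F y in nhds s. y < 0"
    using assms by (intro eventually_nhds_in_open[of "{..<0}", simplified]) auto
  then show ?thesis by eventually_elim (use False assms in simp)
qed

text \<open>Near \<open>s \<noteq> 0\<close> the sign is constant, so the absolute value coincides
  with the linear map \<open>y \<mapsto> sgn s * y\<close>.\<close>

lemma has_real_derivative_comp_abs:
  assumes D: "(\<phi> has_real_derivative D) (at \<bar>s\<bar>)" and "s \<noteq> 0"
  shows "((\<lambda>y. \<phi> \<bar>y\<bar>) has_real_derivative sgn s * D) (at s)"
proof -
  have "((\<lambda>y. \<phi> (sgn s * y)) has_real_derivative D * sgn s) (at s)"
    using D by (intro DERIV_chain2[of \<phi>]) (auto intro!: derivative_eq_intros simp: abs_sgn mult.commute)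
  moreover have "\<forall>\<^sub>F y in nhds s. \<phi> (sgn s * y) = \<phi> \<bar>y\<bar>"
    using eventually_sgn_eq[OF \<open>s \<noteq> 0\<close>] by eventually_elim (simp add: abs_sgn mult.commute)
  ultimately show ?thesis
    by (subst DERIV_cong_ev[where g = "\<lambda>y. \<phi> (sgn s * y)"]) (auto simp: mult.commute eq_commute)
qed

text \<open>This has the shape of the first derivative of \<open>r \<bar>y\<bar>\<close>.
  Differentiating once more produces a second sign, and the two cancel.\<close>

lemma has_real_derivative_sgn_mult_comp_abs:
  assumes D: "(\<phi> has_real_derivative D) (at \<bar>s\<bar>)" and "s \<noteq> 0"
  shows "((\<lambda>y. sgn y * \<phi> \<bar>y\<bar>) has_real_derivative D) (at s)"
proof -
  have "((\<lambda>y. sgn s * \<phi> \<bar>y\<bar>) has_real_derivative sgn s * (sgn s * D)) (at s)"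
    by (intro DERIV_cmult has_real_derivative_comp_abs assms)
  moreover have "sgn s * (sgn s * D) = D"
    using \<open>s \<noteq> 0\<close> by (simp add: sgn_if)
  moreover have "\<forall>\<^sub>F y in nhds s. sgn y * \<phi> \<bar>y\<bar> = sgn s * \<phi> \<bar>y\<bar>"
    using eventually_sgn_eq[OF \<open>s \<noteq> 0\<close>] by eventually_elim simp
  ultimately show ?thesis
    by (subst DERIV_cong_ev[OF refl _ refl]) auto
qed

lemma has_derivative_line: "((\<lambda>t. y + t *\<^sub>R u) has_derivative (\<lambda>t. t *\<^sub>R u)) (at s)"
  by (auto intro!: derivative_eq_intros)

text \<open>Along the \<open>j\<close>-th axis only the \<open>j\<close>-th regularizer term varies,
  so the other coordinates of \<open>y\<close> may vanish even though \<open>r \<bar>_\<bar>\<close>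
  can fail to be differentiable there.\<close>

lemma partial_deriv_objective:
  fixes y :: "real ^ 'n"
  assumes g: "GDERIV f y :> D" and r: "r differentiable (at \<bar>y $ j\<bar>)" and "y $ j \<noteq> 0"
  shows "partial_deriv j (objective f lam r) y = D $ j + lam * (sgn (y $ j) * deriv r \<bar>y $ j\<bar>)"
proof -
  have fd: "(f has_derivative (\<lambda>h. h \<bullet> D)) (at (y + 0 *\<^sub>R axis j 1))"
    using g by (simp add: gderiv_def)
  have 1: "((\<lambda>t. f (y + t *\<^sub>R axis j 1)) has_real_derivative D $ j) (at 0)"
    using has_derivative_compose[OF has_derivative_line, OF fd]
    by (auto simp: has_field_derivative_def inner_axis' mult_commute_abs)
  have 2: "((\<lambda>t. r \<bar>(y + t *\<^sub>R axis j 1) $ i\<bar>) has_real_derivative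
      (if i = j then sgn (y $ j) * deriv r \<bar>y $ j\<bar> else 0)) (at 0)" for i
  proof (cases "i = j")
    case True
    have "((\<lambda>s. r \<bar>s\<bar>) has_real_derivative sgn (y $ j) * deriv r \<bar>y $ j\<bar>) (at (0 + y $ j))"
      using r \<open>y $ j \<noteq> 0\<close>
      by (simp add: has_real_derivative_comp_abs DERIV_deriv_iff_real_differentiable)
    then show ?thesis
      using True unfolding DERIV_shift by (simp add: add.commute)
  qed (simp add: axis_def)
  have "((\<lambda>t. objective f lam r (y + t *\<^sub>R axis j 1)) has_real_derivative
      D $ j + lam * (\<Sum>i\<in>UNIV. if i = j then sgn (y $ j) * deriv r \<bar>y $ j\<bar> else 0)) (at 0)"
    unfolding objective_def by (intro DERIV_add 1 DERIV_cmult DERIV_sum 2)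
  then show ?thesis
    unfolding partial_deriv_def by (intro DERIV_imp_deriv) simp
qed

text \<open>Since \<open>x $ j\<close> is nonzero, the formula for the inner partial derivative
  holds on a whole neighbourhood of \<open>x\<close> along the \<open>i\<close>-th axis and can be
  differentiated. The order of differentiation yields the transposed entry
  \<open>H $ j $ i\<close>.\<close>

lemma hessian_nonzero_objective:
  fixes x :: "real ^ 'n" and H :: "real ^ 'n ^ 'n"
  assumes g: "\<And>x. GDERIV f x :> g x"
    and H: "(g has_derivative (\<lambda>h. H *v h)) (at x)"
    and r: "\<And>t. 0 < t \<Longrightarrow> r differentiable (at t)"
    and r': "\<And>t. 0 < t \<Longrightarrow> deriv r differentiable (at t)"
    and xi: "x $ i \<noteq> 0" and xj: "x $ j \<noteq> 0"
  shows "hessian_nonzero (objective f lam r) x $ i $ j =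
    H $ j $ i + (if i = j then lam * deriv (deriv r) \<bar>x $ i\<bar> else 0)"
proof -
  let ?e = "axis i 1 :: real ^ 'n"
  have Hd: "(g has_derivative (\<lambda>h. H *v h)) (at (x + 0 *\<^sub>R ?e))" using H by simp
  have 1: "((\<lambda>t. g (x + t *\<^sub>R ?e) $ j) has_real_derivative H $ j $ i) (at 0)"
    using bounded_linear.has_derivative[OF bounded_linear_vec_nth[of j]
        has_derivative_compose[OF has_derivative_line, OF Hd]]
    by (auto simp: has_field_derivative_def matrix_vector_mult_scaleR matrix_vector_mul_component
        inner_axis mult_commute_abs)
  have 2: "((\<lambda>t. sgn ((x + t *\<^sub>R ?e) $ j) * deriv r \<bar>(x + t *\<^sub>R ?e) $ j\<bar>) has_real_derivative
      (if i = j then deriv (deriv r) \<bar>x $ i\<bar> else 0)) (at 0)"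
  proof (cases "i = j")
    case True
    have "((\<lambda>s. sgn s * deriv r \<bar>s\<bar>) has_real_derivative deriv (deriv r) \<bar>x $ j\<bar>) (at (0 + x $ j))"
      using r'[of "\<bar>x $ j\<bar>"] xj
      by (simp add: has_real_derivative_sgn_mult_comp_abs DERIV_deriv_iff_real_differentiable)
    then show ?thesis
      using True unfolding DERIV_shift by (simp add: add.commute)
  qed (simp add: axis_def)
  have "\<forall>\<^sub>F t in nhds 0. (x + t *\<^sub>R ?e) $ j \<noteq> 0"
  proof -
    have "((\<lambda>t. (x + t *\<^sub>R ?e) $ j) \<longlongrightarrow> (x + 0 *\<^sub>R ?e) $ j) (nhds 0)"
      by (intro tendsto_intros filterlim_ident)
    from tendsto_imp_eventually_ne[OF this, of 0] show ?thesis
      using xj by simp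
  qed
  then have ev: "\<forall>\<^sub>F t in nhds 0. partial_deriv j (objective f lam r) (x + t *\<^sub>R ?e) =
      g (x + t *\<^sub>R ?e) $ j + lam * (sgn ((x + t *\<^sub>R ?e) $ j) * deriv r \<bar>(x + t *\<^sub>R ?e) $ j\<bar>)"
  proof eventually_elim
    case (elim t)
    then show ?case by (intro partial_deriv_objective g r) auto
  qed
  have "((\<lambda>t. partial_deriv j (objective f lam r) (x + t *\<^sub>R ?e)) has_real_derivative
      H $ j $ i + lam * (if i = j then deriv (deriv r) \<bar>x $ i\<bar> else 0)) (at 0)"
    by (subst DERIV_cong_ev[OF refl ev refl]) (intro DERIV_add DERIV_cmult 1 2)
  then show ?thesis
    using xi xj unfolding hessian_nonzero_def
    by (simp add: partial_deriv_def[of i] DERIV_imp_deriv split: if_splits)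
qed

section \<open>Soft thresholding and the derivative of \<open>T\<close> near a stationary
  point\<close>

text \<open>The strict inequality in stationarity leaves a gap between the gradient component and
  \<open>lam * r'(0+)\<close>. By continuity the thresholding still returns 0 nearby. The
  restriction to \<open>T_domain\<close> keeps the argument of \<open>deriv r\<close>
  nonnegative.\<close>

lemma eventually_Sx_eq_0:
  fixes xs :: "real ^ 'n"
  assumes "lam > 0" "beta > 0" "A1 r"
    and cont: "isCont (grad f) xs"
    and stat: "stationary f lam r xs" and "xs $ i = 0"
  shows "\<forall>\<^sub>F z in nhds (xs, 0). z \<in> T_domain \<longrightarrow> Sx f lam r beta (fst z) (snd z) $ i = 0"
proof -
  let ?c = "grad f xs $ i"
  obtain l where "((\<lambda>t. ereal (deriv r t)) \<longlongrightarrow> l) (at_right 0)" "l > 0"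
    using \<open>A1 r\<close> unfolding A1_def by auto
  moreover from this have "deriv_at_0 r = l"
    unfolding deriv_at_0_def by (intro tendsto_Lim) simp
  ultimately have lim: "((\<lambda>t. ereal (deriv r t)) \<longlongrightarrow> deriv_at_0 r) (at_right 0)" and l0: "deriv_at_0 r > 0"
    by auto
  have "ereal \<bar>?c\<bar> < ereal lam * deriv_at_0 r"
  proof -
    have "- (ereal lam * deriv_at_0 r) < ereal ?c" "ereal ?c < ereal lam * deriv_at_0 r"
      using stat \<open>xs $ i = 0\<close> unfolding stationary_def by auto
    then show ?thesis by (cases "ereal lam * deriv_at_0 r") auto
  qed
  then have "ereal (\<bar>?c\<bar> / lam) < deriv_at_0 r"
    using \<open>lam > 0\<close> by (cases "deriv_at_0 r") (auto simp: field_simps)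
  \<comment> \<open>A finite level inside the gap treats finite and infinite \<open>r'(0+)\<close>
    alike: near the point the weights exceed \<open>m\<close>, while the thresholded quantity stays
    below \<open>lam * m / beta\<close>.\<close>
  then obtain m where m: "\<bar>?c\<bar> / lam < m" "ereal m < deriv_at_0 r"
    using ereal_dense2 by (metis less_ereal.simps(1))
  have "\<forall>\<^sub>F t in at_right 0. m < deriv r t"
    using order_tendstoD(1)[OF lim m(2)] by simp
  then obtain d where d: "d > 0" "\<And>t. 0 < t \<Longrightarrow> t < d \<Longrightarrow> m < deriv r t"
    unfolding eventually_at_right_field by auto
  have fst_lim: "(fst \<longlongrightarrow> xs) (nhds (xs, 0 :: real ^ 'n))"
    and snd_lim: "(snd \<longlongrightarrow> 0) (nhds (xs, 0 :: real ^ 'n))"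
    using tendsto_fst[OF filterlim_ident, of "(xs, 0 :: real ^ 'n)"]
      tendsto_snd[OF filterlim_ident, of "(xs, 0 :: real ^ 'n)"] by (auto simp: id_def)
  have "((\<lambda>z. (fst z - (1 / beta) *\<^sub>R grad f (fst z)) $ i) \<longlongrightarrow> (xs - (1 / beta) *\<^sub>R grad f xs) $ i)
      (nhds (xs, 0 :: real ^ 'n))"
    by (intro tendsto_intros fst_lim isCont_tendsto_compose[OF cont])
  moreover have "\<bar>(xs - (1 / beta) *\<^sub>R grad f xs) $ i\<bar> < lam * m / beta"
    using \<open>xs $ i = 0\<close> m(1) \<open>lam > 0\<close> \<open>beta > 0\<close> by (simp add: field_simps abs_divide)
  ultimately have "\<forall>\<^sub>F z in nhds (xs, 0 :: real ^ 'n).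
      \<bar>(fst z - (1 / beta) *\<^sub>R grad f (fst z)) $ i\<bar> < lam * m / beta"
    by (intro order_tendstoD(2)[OF tendsto_rabs])
  moreover have "((\<lambda>z. \<bar>fst z $ i\<bar> + snd z $ i) \<longlongrightarrow> \<bar>xs $ i\<bar> + 0 $ i) (nhds (xs, 0 :: real ^ 'n))"
    by (intro tendsto_intros fst_lim snd_lim)
  then have "\<forall>\<^sub>F z in nhds (xs, 0 :: real ^ 'n). \<bar>fst z $ i\<bar> + snd z $ i < d"
    using d(1) \<open>xs $ i = 0\<close> by (intro order_tendstoD(2)) auto
  ultimately show ?thesis
  proof eventually_elim
    case (elim z)
    show ?case
    proof
      assume "z \<in> T_domain"
      then have nn: "\<bar>fst z $ i\<bar> + snd z $ i \<ge> 0" by (auto simp: T_domain_def)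
      have w: "ereal m < weight r (fst z) (snd z) i"
        unfolding weight_def using nn m(2) d(2) elim(2) by auto
      show "Sx f lam r beta (fst z) (snd z) $ i = 0"
      proof (cases "weight r (fst z) (snd z) i")
        case (real u)
        then have "lam * m / beta < lam * u / beta"
          using w \<open>lam > 0\<close> \<open>beta > 0\<close> by (simp add: divide_strict_right_mono)
        then show ?thesis using elim(1) real by (simp add: Sx_def Let_def max_def)
      \<comment> \<open>An infinite weight gives 0 by the convention in \<open>Sx\<close>, and the
        value minus infinity contradicts the lower bound \<open>m\<close>.\<close>
      qed (use w in \<open>auto simp: Sx_def Let_def\<close>)
    qed
  qed
qed

text \<open>At the stationary point the magnitude left after thresholding is
  \<open>\<bar>xs $ i\<bar> > 0\<close>. Hence nearby the maximum is attained by its first argument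
  and all signs are frozen at \<sigma>, which leaves a differentiable expression.\<close>

lemma eventually_Sx_eq:
  fixes xs :: "real ^ 'n"
  assumes "lam > 0" "beta > 0"
    and r': "deriv r differentiable (at \<bar>xs $ i\<bar>)"
    and r'_nonneg: "\<And>t. 0 < t \<Longrightarrow> 0 \<le> deriv r t"
    and cont: "isCont (grad f) xs"
    and stat: "stationary f lam r xs" and xi: "xs $ i \<noteq> 0"
  defines "\<sigma> \<equiv> sgn (xs $ i)"
  shows "\<forall>\<^sub>F z in nhds (xs, 0 :: real ^ 'n). Sx f lam r beta (fst z) (snd z) $ i =
    fst z $ i - grad f (fst z) $ i / beta - \<sigma> * (lam / beta) * deriv r (\<sigma> * fst z $ i + snd z $ i)"
proof -
  have fst_lim: "(fst \<longlongrightarrow> xs) (nhds (xs, 0 :: real ^ 'n))"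
    and snd_lim: "(snd \<longlongrightarrow> 0) (nhds (xs, 0 :: real ^ 'n))"
    using tendsto_fst[OF filterlim_ident, of "(xs, 0 :: real ^ 'n)"]
      tendsto_snd[OF filterlim_ident, of "(xs, 0 :: real ^ 'n)"] by (auto simp: id_def)
  have \<sigma>: "\<sigma> * xs $ i = \<bar>xs $ i\<bar>" "\<sigma> * \<sigma> = 1"
    using xi by (auto simp: \<sigma>_def sgn_if)
  let ?v = "\<lambda>z. (fst z - (1 / beta) *\<^sub>R grad f (fst z)) $ i"
  let ?s = "\<lambda>z. \<sigma> * fst z $ i + snd z $ i"
  have g: "grad f xs $ i = - lam * \<sigma> * deriv r \<bar>xs $ i\<bar>"
    using stat xi unfolding stationary_def \<sigma>_def by blast
  have s_lim: "(?s \<longlongrightarrow> \<bar>xs $ i\<bar>) (nhds (xs, 0 :: real ^ 'n))"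
  proof -
    have "(?s \<longlongrightarrow> \<sigma> * xs $ i + 0 $ i) (nhds (xs, 0 :: real ^ 'n))"
      by (intro tendsto_intros fst_lim snd_lim)
    then show ?thesis by (simp add: \<sigma>)
  qed
  have v_lim: "(?v \<longlongrightarrow> (xs - (1 / beta) *\<^sub>R grad f xs) $ i) (nhds (xs, 0 :: real ^ 'n))"
    by (intro tendsto_intros fst_lim isCont_tendsto_compose[OF cont])
  have "isCont (deriv r) \<bar>xs $ i\<bar>"
    using r' by (simp add: differentiable_imp_continuous_within)
  then have w_lim: "((\<lambda>z. deriv r (?s z)) \<longlongrightarrow> deriv r \<bar>xs $ i\<bar>) (nhds (xs, 0 :: real ^ 'n))"
    by (rule isCont_tendsto_compose[OF _ s_lim])
  have "((\<lambda>z. \<sigma> * ?v z - lam * deriv r (?s z) / beta) \<longlongrightarrow>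
      \<sigma> * (xs - (1 / beta) *\<^sub>R grad f xs) $ i - lam * deriv r \<bar>xs $ i\<bar> / beta) (nhds (xs, 0 :: real ^ 'n))"
    using \<open>beta > 0\<close> by (intro tendsto_intros v_lim w_lim) auto
  \<comment> \<open>Stationarity makes the gradient term and the weight term cancel.\<close>
  moreover have v0: "\<sigma> * (xs - (1 / beta) *\<^sub>R grad f xs) $ i - lam * deriv r \<bar>xs $ i\<bar> / beta = \<bar>xs $ i\<bar>"
    using \<sigma> by (simp add: g algebra_simps)
  ultimately have e1: "\<forall>\<^sub>F z in nhds (xs, 0 :: real ^ 'n). 0 < \<sigma> * ?v z - lam * deriv r (?s z) / beta"
    using xi by (intro order_tendstoD(1)[where a = 0]) auto
  have e2: "\<forall>\<^sub>F z in nhds (xs, 0 :: real ^ 'n). 0 < ?s z"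
    using xi by (intro order_tendstoD(1)[OF s_lim]) auto
  have e3: "\<forall>\<^sub>F z in nhds (xs, 0 :: real ^ 'n). sgn (fst z $ i) = \<sigma>"
    using eventually_sgn_eq[OF xi] unfolding \<sigma>_def
    by (rule eventually_compose_filterlim[OF _ tendsto_vec_nth[OF fst_lim]])
  from e1 e2 e3 show ?thesis
  proof eventually_elim
    case (elim z)
    let ?w = "deriv r (?s z)"
    \<comment> \<open>A nonnegative threshold lets the positivity of the reduced magnitude pass to
      \<open>\<sigma> * ?v z\<close>, which fixes the sign of \<open>?v z\<close>.\<close>
    have "0 \<le> lam * ?w / beta"
      using r'_nonneg[OF elim(2)] \<open>lam > 0\<close> \<open>beta > 0\<close> by simp
    then have "\<sigma> * ?v z > 0" using elim(1) by linarith
    then have sv: "sgn (?v z) = \<sigma>" "\<bar>?v z\<bar> = \<sigma> * ?v z"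
      using xi by (auto simp: \<sigma>_def sgn_if zero_less_mult_iff split: if_splits)
    have "\<bar>fst z $ i\<bar> = \<sigma> * fst z $ i"
      using elim(3) by (metis abs_sgn mult.commute)
    then have "weight r (fst z) (snd z) i = ereal ?w"
      using elim(2) by (simp add: weight_def)
    then have "Sx f lam r beta (fst z) (snd z) $ i = \<sigma> * max (\<sigma> * ?v z - lam * ?w / beta) 0"
      using sv by (simp add: Sx_def Let_def)
    also have "\<dots> = \<sigma> * (\<sigma> * ?v z) - \<sigma> * (lam * ?w / beta)"
      using elim(1) by (simp add: max_def right_diff_distrib)
    also have "\<sigma> * (\<sigma> * ?v z) = ?v z"
      using \<sigma>(2) by (metis mult.assoc mult_1)
    finally show ?case by simp
  qed
qed

lemma has_derivative_vecI:
  fixes F :: "'a::real_normed_vector \<Rightarrow> real ^ 'n"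
  assumes "\<And>i. ((\<lambda>x. F x $ i) has_derivative (\<lambda>h. F' h $ i)) (at a within S)"
  shows "(F has_derivative F') (at a within S)"
  using assms by (subst has_derivative_componentwise_within) (auto simp: Basis_vec_def inner_axis)

text \<open>Each coordinate of \<open>T\<close> agrees near \<open>(xs, 0)\<close>, within the
  domain, with one of the two local formulas for \<open>Sx\<close>, and these are differentiated
  instead.\<close>

lemma T_map_has_derivative:
  fixes f :: "real ^ 'n \<Rightarrow> real" and H :: "real ^ 'n ^ 'n"
  assumes "lam > 0" "beta > 0" "A1 r"
    and g: "(grad f has_derivative (\<lambda>h. H *v h)) (at xs)"
    and stat: "stationary f lam r xs"
  shows "(T_map f lam r alpha beta mu has_derivative
      (\<lambda>(h, k). (\<chi> i. if xs $ i = 0 then (1 - alpha) * h $ i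
         else h $ i - alpha / beta * ((H *v h) $ i +
           lam * deriv (deriv r) \<bar>xs $ i\<bar> * (h $ i + sgn (xs $ i) * k $ i)),
         (1 - alpha * (1 - mu)) *\<^sub>R k))) (at (xs, 0) within T_domain)"
proof -
  let ?S = "\<lambda>z. Sx f lam r beta (fst z) (snd z)"
  let ?D = "\<lambda>z. \<chi> i. if xs $ i = 0 then (1 - alpha) * fst z $ i
         else fst z $ i - alpha / beta * ((H *v fst z) $ i +
           lam * deriv (deriv r) \<bar>xs $ i\<bar> * (fst z $ i + sgn (xs $ i) * snd z $ i))"
  have cont: "isCont (grad f) xs"
    using g by (rule has_derivative_continuous)
  have dom: "(xs, 0) \<in> T_domain" by (simp add: T_domain_def)
  have fst_i: "((\<lambda>z. fst z $ i) has_derivative (\<lambda>z. fst z $ i)) (at (xs, 0) within T_domain)"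
    and snd_i: "((\<lambda>z. snd z $ i) has_derivative (\<lambda>z. snd z $ i)) (at (xs, 0) within T_domain)"
    for i :: 'n
    by (intro bounded_linear.has_derivative[OF bounded_linear_vec_nth] has_derivative_fst
        has_derivative_snd has_derivative_ident)+
  have "((\<lambda>z. ((1 - alpha) *\<^sub>R fst z + alpha *\<^sub>R ?S z) $ i) has_derivative (\<lambda>z. ?D z $ i))
      (at (xs, 0) within T_domain)" for i
  proof (cases "xs $ i = 0")
    case True
    have ev: "\<forall>\<^sub>F z in nhds (xs, 0). z \<in> T_domain \<longrightarrow> ?S z $ i = 0"
      using eventually_Sx_eq_0[OF assms(1-3) cont stat True] .
    have "((\<lambda>z. (1 - alpha) * fst z $ i) has_derivative (\<lambda>z. ?D z $ i))
      (at (xs, 0) within T_domain)"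
      using has_derivative_mult_right[OF fst_i] True by simp
    then show ?thesis
    proof (rule has_derivative_transform_eventually)
      show "\<forall>\<^sub>F z in at (xs, 0) within T_domain.
          (1 - alpha) * fst z $ i = ((1 - alpha) *\<^sub>R fst z + alpha *\<^sub>R ?S z) $ i"
        unfolding eventually_at_filter using ev by eventually_elim simp
      show "(1 - alpha) * fst (xs, 0) $ i =
          ((1 - alpha) *\<^sub>R fst (xs, 0) + alpha *\<^sub>R ?S (xs, 0)) $ i"
        using eventually_nhds_x_imp_x[OF ev] dom by simp
    qed (rule dom)
  next
    case False
    define \<sigma> where "\<sigma> = sgn (xs $ i)"
    have \<sigma>: "\<sigma> * xs $ i = \<bar>xs $ i\<bar>" "\<sigma> * \<sigma> = 1"
      using False by (auto simp: \<sigma>_def sgn_if)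
    have r': "deriv r differentiable (at \<bar>xs $ i\<bar>)" "\<And>t. 0 < t \<Longrightarrow> 0 \<le> deriv r t"
      using \<open>A1 r\<close> False by (auto simp: A1_def)
    let ?G = "\<lambda>z. fst z $ i - grad f (fst z) $ i / beta -
        \<sigma> * (lam / beta) * deriv r (\<sigma> * fst z $ i + snd z $ i)"
    have ev: "\<forall>\<^sub>F z in nhds (xs, 0). ?S z $ i = ?G z"
      using eventually_Sx_eq[OF assms(1,2) r' cont stat False] unfolding \<sigma>_def .
    have dr: "(deriv r has_derivative (*) (deriv (deriv r) \<bar>xs $ i\<bar>)) (at \<bar>xs $ i\<bar>)"
      using r'(1) by (simp add: DERIV_deriv_iff_real_differentiable flip: has_field_derivative_def)
    have d1: "((\<lambda>z. \<sigma> * fst z $ i + snd z $ i) has_derivative (\<lambda>z. \<sigma> * fst z $ i + snd z $ i))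
        (at (xs, 0 :: real ^ 'n) within T_domain)"
      by (intro has_derivative_add has_derivative_mult_right fst_i snd_i)
    have d2: "((\<lambda>z. deriv r (\<sigma> * fst z $ i + snd z $ i)) has_derivative
        (\<lambda>z. deriv (deriv r) \<bar>xs $ i\<bar> * (\<sigma> * fst z $ i + snd z $ i)))
        (at (xs, 0 :: real ^ 'n) within T_domain)"
      by (rule has_derivative_compose[OF d1]) (use dr \<sigma> in simp)
    have "(fst has_derivative fst) (at (xs, 0 :: real ^ 'n) within T_domain)"
      by (rule has_derivative_fst[OF has_derivative_ident])
    then have d3: "((\<lambda>z. grad f (fst z)) has_derivative (\<lambda>z. H *v fst z))
        (at (xs, 0 :: real ^ 'n) within T_domain)"
      by (rule has_derivative_compose) (use g in simp)
    have d4: "((\<lambda>z. (1 - alpha) * fst z $ i + alpha * ?G z) has_derivative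
        (\<lambda>z. (1 - alpha) * fst z $ i + alpha * (fst z $ i - (H *v fst z) $ i / beta -
          \<sigma> * (lam / beta) * (deriv (deriv r) \<bar>xs $ i\<bar> * (\<sigma> * fst z $ i + snd z $ i)))))
        (at (xs, 0 :: real ^ 'n) within T_domain)"
      by (intro has_derivative_add has_derivative_diff has_derivative_mult_right fst_i d2
          bounded_linear.has_derivative[OF bounded_linear_divide]
          bounded_linear.has_derivative[OF bounded_linear_vec_nth] d3)
    \<comment> \<open>The outer sign cancels the inner one on the \<open>x\<close>-part and survives
      only on the \<epsilon>-part.\<close>
    have "(1 - alpha) * fst z $ i + alpha * (fst z $ i - (H *v fst z) $ i / beta -
          \<sigma> * (lam / beta) * (deriv (deriv r) \<bar>xs $ i\<bar> * (\<sigma> * fst z $ i + snd z $ i))) = ?D z $ i"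
      for z :: "(real ^ 'n) \<times> (real ^ 'n)"
    proof -
      have "\<sigma> * (lam / beta) * (deriv (deriv r) \<bar>xs $ i\<bar> * (\<sigma> * fst z $ i + snd z $ i)) =
          lam / beta * deriv (deriv r) \<bar>xs $ i\<bar> * ((\<sigma> * \<sigma>) * fst z $ i + \<sigma> * snd z $ i)"
        by (simp only: algebra_simps)
      moreover have "?D z $ i = fst z $ i - alpha / beta * ((H *v fst z) $ i +
          lam * deriv (deriv r) \<bar>xs $ i\<bar> * (fst z $ i + \<sigma> * snd z $ i))"
        using False by (simp add: \<sigma>_def)
      ultimately show ?thesis
        using \<open>beta > 0\<close> by (simp only: \<sigma>(2)) (simp add: field_simps)
    qed
    with d4 have d5: "((\<lambda>z. (1 - alpha) * fst z $ i + alpha * ?G z) has_derivative (\<lambda>z. ?D z $ i))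
        (at (xs, 0 :: real ^ 'n) within T_domain)"
      by simp
    then show ?thesis
    proof (rule has_derivative_transform_eventually)
      show "\<forall>\<^sub>F z in at (xs, 0) within T_domain.
          (1 - alpha) * fst z $ i + alpha * ?G z = ((1 - alpha) *\<^sub>R fst z + alpha *\<^sub>R ?S z) $ i"
        unfolding eventually_at_filter using ev by eventually_elim simp
      show "(1 - alpha) * fst (xs, 0) $ i + alpha * ?G (xs, 0) =
          ((1 - alpha) *\<^sub>R fst (xs, 0) + alpha *\<^sub>R ?S (xs, 0)) $ i"
        using eventually_nhds_x_imp_x[OF ev] by simp
    qed (rule dom)
  qed
  then have "((\<lambda>z. (1 - alpha) *\<^sub>R fst z + alpha *\<^sub>R ?S z) has_derivative ?D)
      (at (xs, 0) within T_domain)"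
    by (rule has_derivative_vecI)
  then have "((\<lambda>z. ((1 - alpha) *\<^sub>R fst z + alpha *\<^sub>R ?S z, (1 - alpha * (1 - mu)) *\<^sub>R snd z))
      has_derivative (\<lambda>z. (?D z, (1 - alpha * (1 - mu)) *\<^sub>R snd z))) (at (xs, 0) within T_domain)"
    by (intro has_derivative_Pair has_derivative_scaleR_right has_derivative_snd has_derivative_ident)
  then show ?thesis
    by (simp add: T_map_def case_prod_beta')
qed

text \<open>A property holding eventually in \<open>nhds\<close> holds at the point itself, so the
  two local formulas for \<open>Sx\<close> can be evaluated there.\<close>

lemma T_map_fixed_point:
  fixes xs :: "real ^ 'n"
  assumes "lam > 0" "beta > 0" "A1 r" and cont: "isCont (grad f) xs" and stat: "stationary f lam r xs"
  shows "T_map f lam r alpha beta mu (xs, 0) = (xs, 0)"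
proof -
  have "Sx f lam r beta xs 0 $ i = xs $ i" for i
  proof (cases "xs $ i = 0")
    case True
    then show ?thesis
      using eventually_nhds_x_imp_x[OF eventually_Sx_eq_0[OF assms True]] by (simp add: T_domain_def)
  next
    case False
    then have r': "deriv r differentiable (at \<bar>xs $ i\<bar>)" "\<And>t. 0 < t \<Longrightarrow> 0 \<le> deriv r t"
      using \<open>A1 r\<close> by (auto simp: A1_def)
    have "grad f xs $ i = - lam * sgn (xs $ i) * deriv r \<bar>xs $ i\<bar>"
      using stat False by (simp add: stationary_def)
    moreover have "sgn (xs $ i) * xs $ i = \<bar>xs $ i\<bar>" by (simp add: abs_sgn mult.commute)
    ultimately show ?thesis
      using eventually_nhds_x_imp_x[OF eventually_Sx_eq[OF assms(1,2) r' cont stat False]] by simp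
  qed
  then have "Sx f lam r beta xs 0 = xs" by (simp add: vec_eq_iff)
  then show ?thesis by (simp add: T_map_def flip: scaleR_left_distrib)
qed

section \<open>Stacked coordinates and the Jacobian matrix\<close>

lemma stack_nth: "stack z $ Inl i = fst z $ i" "stack z $ Inr j = snd z $ j"
  by (simp_all add: stack_def)

lemma unstack_nth: "fst (unstack u) $ i = u $ Inl i" "snd (unstack u) $ j = u $ Inr j"
  by (simp_all add: unstack_def)

lemma unstack_stack [simp]: "unstack (stack z) = z"
  by (simp add: unstack_def stack_def)

lemma stack_unstack [simp]: "stack (unstack u) = u"
proof -
  have "stack (unstack u) $ k = u $ k" for k
    by (cases k) (simp_all add: stack_def unstack_def)
  then show ?thesis by (simp add: vec_eq_iff)
qed

lemma linear_stack: "linear stack"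
proof (rule linearI)
  fix z w :: "(real ^ 'n) \<times> (real ^ 'm)" and c :: real
  have "stack (z + w) $ k = (stack z + stack w) $ k" "stack (c *\<^sub>R z) $ k = (c *\<^sub>R stack z) $ k" for k
    by (cases k; simp add: stack_def)+
  then show "stack (z + w) = stack z + stack w" "stack (c *\<^sub>R z) = c *\<^sub>R stack z"
    by (simp_all add: vec_eq_iff)
qed

lemma linear_unstack: "linear unstack"
  by (rule linearI) (simp_all add: unstack_def prod_eq_iff vec_eq_iff)

text \<open>Derivatives within a set need not be unique, and \<open>(xs, 0)\<close> lies on the
  boundary of the domain. Uniqueness holds because arbitrarily small positive steps along every
  coordinate axis stay in the domain.\<close>

lemma jacobian_within_T_domain:
  fixes T :: "(real ^ 'n) \<times> (real ^ 'n) \<Rightarrow> (real ^ 'n) \<times> (real ^ 'n)"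
  assumes T: "(T has_derivative T') (at z within T_domain)" and z: "z \<in> T_domain"
  shows "jacobian_within T T_domain z *v stack h = stack (T' h)"
proof -
  let ?D = "stack ` (T_domain :: ((real ^ 'n) \<times> (real ^ 'n)) set)"
  let ?J = "jacobian_within T T_domain z"
  have D: "?D = {u. \<forall>j. 0 \<le> u $ Inr j}"
  proof (intro set_eqI iffI)
    fix u :: "real ^ ('n + 'n)" assume "u \<in> {u. \<forall>j. 0 \<le> u $ Inr j}"
    then have "unstack u \<in> T_domain" by (simp add: unstack_def T_domain_def)
    then show "u \<in> ?D" by (metis imageI stack_unstack)
  qed (auto simp: T_domain_def stack_def)
  have bl: "bounded_linear (stack :: (real ^ 'n) \<times> (real ^ 'n) \<Rightarrow> _)"
    "bounded_linear (unstack :: _ \<Rightarrow> (real ^ 'n) \<times> (real ^ 'n))"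
    using linear_stack linear_unstack by (auto simp: linear_conv_bounded_linear)
  have "unstack ` ?D = T_domain" by (simp add: image_image)
  with T have "(T has_derivative T') (at (unstack (stack z)) within unstack ` ?D)"
    by (simp only: unstack_stack)
  then have "((\<lambda>u. T (unstack u)) has_derivative (\<lambda>u. T' (unstack u))) (at (stack z) within ?D)"
    by (rule has_derivative_in_compose[OF bounded_linear_imp_has_derivative[OF bl(2)]])
  then have der: "((\<lambda>u. stack (T (unstack u))) has_derivative (\<lambda>u. stack (T' (unstack u))))
      (at (stack z) within ?D)"
    by (rule bounded_linear.has_derivative[OF bl(1)])
  then have "((\<lambda>u. stack (T (unstack u))) has_derivative (\<lambda>u. ?J *v u)) (at (stack z) within ?D)"
    unfolding jacobian_within_def by (auto simp: differentiable_def simp flip: jacobian_works)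
  then have "(\<lambda>u. ?J *v u) = (\<lambda>u. stack (T' (unstack u)))"
  proof (rule frechet_derivative_unique_within[OF _ der])
    fix b :: "real ^ ('n + 'n)" and e :: real assume "b \<in> Basis" "e > 0"
    then obtain k where "b = axis k 1" by (auto simp: Basis_vec_def)
    moreover have "0 \<le> stack z $ Inr j" for j
      using z by (auto simp: T_domain_def stack_def)
    ultimately have "stack z + (e / 2) *\<^sub>R b \<in> ?D"
      unfolding D using \<open>e > 0\<close> by (auto simp: axis_def)
    then show "\<exists>d. 0 < \<bar>d\<bar> \<and> \<bar>d\<bar> < e \<and> stack z + d *\<^sub>R b \<in> ?D"
      using \<open>e > 0\<close> by (intro exI[of _ "e / 2"]) auto
  qed
  then show ?thesis by (metis unstack_stack)
qed

section \<open>Spectral analysis of the Jacobian\<close>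

lemma matrix_inner_symmetric:
  fixes A :: "real ^ 'n ^ 'n"
  assumes "\<And>i j. A $ i $ j = A $ j $ i"
  shows "u \<bullet> (A *v v) = v \<bullet> (A *v u)"
proof -
  have "transpose A = A" using assms by (simp add: transpose_def vec_eq_iff)
  then show ?thesis
    by (metis dot_lmul_matrix inner_commute vector_transpose_matrix)
qed

lemma continuous_objective:
  assumes "\<And>x. isCont f x" "continuous_on {0..} r"
  shows "continuous_on UNIV (objective f lam r)"
  unfolding objective_def
  by (intro continuous_intros continuous_on_compose2[OF assms(2)]
      continuous_at_imp_continuous_on) (auto intro: assms(1))

(* The assumption lip_boundary concerns only the case F(xs) = F0, where a Lipschitz constant of
   grad f on the sublevel set alone need not control the second derivative of f at xs (xs may be
   an isolated point of that set). If F(xs) < F0, the premise is false. *)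
theorem theorem3p5:
  fixes f :: "real ^ 'n \<Rightarrow> real" and r :: "real \<Rightarrow> real"
    and lam alpha beta mu rho L F0 :: real
    and x0 eps0 xs :: "real ^ 'n"
  assumes "twice_cont_differentiable f"
    and "lam > 0"
    and "A1 r"
    and "A2 (objective f lam r)"
    and "\<forall>i. 0 \<le> eps0 $ i"
    and "F0 = objective_eps f lam r x0 eps0"
    and "A3 (objective f lam r) F0"
    and "L-lipschitz_on (sublevel (objective f lam r) F0) (grad f)"
    and lip_boundary: "objective f lam r xs = F0 \<Longrightarrow>
           \<exists>U. open U \<and> xs \<in> U \<and> L-lipschitz_on U (grad f)"
    and "rho > 0"
    and "\<And>x. x \<in> sublevel (objective f lam r) F0 \<Longrightarrow> stationary f lam r x \<Longrightarrow>
           spectral_norm (hessian_nonzero (objective f lam r) x) \<le> rho"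
    and "0 < alpha" and "alpha < 1"
    and "0 < mu" and "mu < 1"
    and "beta > 0" and "beta > alpha * L / 2"
    and "xs \<in> sublevel (objective f lam r) F0"
    and "stationary f lam r xs"
  shows "(strict_saddle f lam r xs \<longleftrightarrow>
            unstable_fixed_point (T_map f lam r alpha beta mu) T_domain (xs, 0)) \<and>
         (alpha < beta / rho \<longrightarrow>
            invertible (jacobian_within (T_map f lam r alpha beta mu) T_domain (xs, 0)))"
proof -
  obtain g H where gd: "\<And>x. GDERIV f x :> g x"
    and Hd: "\<And>x. (g has_derivative (\<lambda>h. H x *v h)) (at x)"
    and Hc: "continuous_on UNIV H"
    using \<open>twice_cont_differentiable f\<close> unfolding twice_cont_differentiable_def by auto
  have gr: "grad f = g" using grad_eqI[OF gd] by blast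
  have r_diff: "r differentiable (at t)" "deriv r differentiable (at t)" if "t > 0" for t
    using \<open>A1 r\<close> that by (auto simp: A1_def)
  have cont_g: "isCont (grad f) xs"
    unfolding gr using Hd by (rule has_derivative_continuous)
  let ?P = "hessian_nonzero (objective f lam r) xs"
  let ?J = "jacobian_within (T_map f lam r alpha beta mu) T_domain (xs, 0)"
  \<comment> \<open>The diagonal contribution of the regularizer: on the nonzero coordinates
    \<open>?P\<close> is \<open>H xs\<close> plus the diagonal matrix of the
    \<open>R i\<close>.\<close>
  define R where "R i = lam * deriv (deriv r) \<bar>xs $ i\<bar>" for i
  define c where "c = 1 - alpha * (1 - mu)"
  have c: "0 < c" "c < 1"
  proof -
    have "alpha * (1 - mu) < 1 * 1"
      using assms by (intro mult_strict_mono) auto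
    then show "0 < c" by (simp add: c_def)
    show "c < 1" using assms by (simp add: c_def)
  qed

  have H_sym: "H xs $ j $ i = H xs $ i $ j" for i j
    using second_derivative_symmetric[OF gd Hd Hc, of "axis j 1" xs "axis i 1"]
    by (simp add: inner_axis' inner_axis matrix_vector_mul_component)
  have P_entry: "?P $ i $ j = (if xs $ i \<noteq> 0 \<and> xs $ j \<noteq> 0 then H xs $ i $ j + (if i = j then R i else 0) else 0)"
    for i j
    using hessian_nonzero_objective[OF gd Hd r_diff, of xs i j lam]
    by (auto simp: R_def H_sym hessian_nonzero_def)
  have P_sym: "u \<bullet> (?P *v v) = v \<bullet> (?P *v u)" for u v
    by (rule matrix_inner_symmetric) (auto simp: P_entry H_sym)
  have P_zero: "(?P *v v) $ i = 0" if "xs $ i = 0" for v i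
    using that by (simp add: matrix_vector_mult_def P_entry)
  have P_apply: "(?P *v v) $ i = (H xs *v v) $ i + R i * v $ i"
    if "xs $ i \<noteq> 0" "\<And>j. xs $ j = 0 \<Longrightarrow> v $ j = 0" for v i
  proof -
    have "(?P *v v) $ i = (\<Sum>j\<in>UNIV. H xs $ i $ j * v $ j + (if j = i then R i * v $ i else 0))"
      unfolding matrix_vector_mult_def vec_lambda_beta
      using that by (intro sum.cong) (auto simp: P_entry algebra_simps)
    then show ?thesis by (simp add: sum.distrib matrix_vector_mult_def)
  qed

  have "\<exists>U. open U \<and> xs \<in> U \<and> L-lipschitz_on U (grad f)"
  proof (cases "objective f lam r xs = F0")
    case False
    have "isCont f x" for x
      using gd[of x] unfolding gderiv_def by (rule has_derivative_continuous)
    then have "continuous_on UNIV (objective f lam r)"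
      using \<open>A1 r\<close> by (intro continuous_objective) (auto simp: A1_def)
    then have "open {x. objective f lam r x < F0}"
      by (intro open_Collect_less continuous_intros)
    moreover have "L-lipschitz_on {x. objective f lam r x < F0} (grad f)"
      using \<open>L-lipschitz_on (sublevel (objective f lam r) F0) (grad f)\<close>
      by (rule lipschitz_on_subset) (auto simp: sublevel_def)
    ultimately show ?thesis
      using \<open>xs \<in> sublevel (objective f lam r) F0\<close> False by (force simp: sublevel_def)
  qed (rule lip_boundary)
  then have H_bound: "norm (H xs *v h) \<le> L * norm h" for h
    using has_derivative_lipschitz_bound[OF Hd] unfolding gr by blast
  have R_nonpos: "R i \<le> 0" if "xs $ i \<noteq> 0" for i
  proof -
    have "concave_on {0<..} r"
      using \<open>A1 r\<close> unfolding A1_def concave_on_def by (auto intro: convex_on_subset)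
    then have "deriv (deriv r) \<bar>xs $ i\<bar> \<le> 0"
      using that r_diff by (intro concave_deriv2_nonpos[where t = "\<bar>xs $ i\<bar>" and r = r])
        (auto simp: DERIV_deriv_iff_real_differentiable)
    then show ?thesis using \<open>lam > 0\<close> by (simp add: R_def mult_nonneg_nonpos)
  qed
  \<comment> \<open>The bound is one-sided: the Lipschitz constant controls \<open>H xs\<close>, and
    the terms \<open>R i\<close>, possibly very negative, can only lower the form.\<close>
  have quad_le: "d \<bullet> (?P *v d) \<le> L * (d \<bullet> d)" if d: "\<And>j. xs $ j = 0 \<Longrightarrow> d $ j = 0" for d
  proof -
    have "d \<bullet> (?P *v d) \<le> d \<bullet> (H xs *v d)"
      unfolding inner_vec_def
    proof (rule sum_mono)
      fix i
      have "R i * (d $ i * d $ i) \<le> 0" if "xs $ i \<noteq> 0"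
        using R_nonpos[OF that] by (simp add: mult_nonpos_nonneg)
      then show "d $ i \<bullet> (?P *v d) $ i \<le> d $ i \<bullet> (H xs *v d) $ i"
        using d[of i] P_apply[of i d] d by (cases "xs $ i = 0") (auto simp: algebra_simps)
    qed
    also have "\<dots> \<le> norm d * norm (H xs *v d)" by (rule norm_cauchy_schwarz)
    also have "\<dots> \<le> norm d * (L * norm d)" by (intro mult_left_mono H_bound) simp
    finally show ?thesis by (simp add: dot_square_norm power2_eq_square algebra_simps)
  qed

  have "(T_map f lam r alpha beta mu has_derivative
      (\<lambda>(h, k). (\<chi> i. if xs $ i = 0 then (1 - alpha) * h $ i
         else h $ i - alpha / beta * ((H xs *v h) $ i + R i * (h $ i + sgn (xs $ i) * k $ i)),
         c *\<^sub>R k))) (at (xs, 0) within T_domain)"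
    unfolding R_def c_def
    by (rule T_map_has_derivative) (use assms Hd in \<open>simp_all add: gr\<close>)
  moreover have "(xs, 0) \<in> T_domain" by (simp add: T_domain_def)
  ultimately have "?J *v stack z = stack ((\<lambda>(h, k). (\<chi> i. if xs $ i = 0 then (1 - alpha) * h $ i
         else h $ i - alpha / beta * ((H xs *v h) $ i + R i * (h $ i + sgn (xs $ i) * k $ i)),
         c *\<^sub>R k)) z)" for z
    by (rule jacobian_within_T_domain)
  from this[of "unstack h" for h] have J: "?J *v h = stack (\<chi> i. if xs $ i = 0 then (1 - alpha) * h $ Inl i
         else h $ Inl i - alpha / beta * ((H xs *v fst (unstack h)) $ i +
           R i * (h $ Inl i + sgn (xs $ i) * h $ Inr i)), c *\<^sub>R snd (unstack h))" for h
    unfolding stack_unstack case_prod_beta' unstack_nth .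
  have J_Inr: "(?J *v h) $ Inr j = c * h $ Inr j" for h j
    by (simp add: J stack_nth unstack_nth)
  have J_Inl0: "(?J *v h) $ Inl i = (1 - alpha) * h $ Inl i" if "xs $ i = 0" for h i
    using that by (simp add: J stack_nth)
  \<comment> \<open>On vectors supported on the nonzero \<open>x\<close>-coordinates the coupling to
    \<epsilon> disappears and the Jacobian acts as \<open>I - (alpha / beta) P\<close>.\<close>
  have J_Inl: "(?J *v h) $ Inl i = h $ Inl i - alpha / beta * (?P *v fst (unstack h)) $ i"
    if "\<And>j. h $ Inr j = 0" "\<And>j. xs $ j = 0 \<Longrightarrow> h $ Inl j = 0" for h i
  proof (cases "xs $ i = 0")
    case True
    then show ?thesis using J_Inl0[OF True] that by (simp add: P_zero)
  next
    case False
    then show ?thesis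
      using that P_apply[OF False, of "fst (unstack h)"] by (simp add: J stack_nth unstack_nth)
  qed

  have "strict_saddle f lam r xs \<longleftrightarrow> (\<exists>e. complex_eigenvalue ?J e \<and> 1 < cmod e)"
  proof
    assume "strict_saddle f lam r xs"
    then obtain d where "d \<bullet> (?P *v d) < 0" unfolding strict_saddle_def by blast
    then obtain k e where k: "k < 0" and "e \<noteq> 0" and Pe: "?P *v e = k *\<^sub>R e"
      using symmetric_matrix_negative_eigenvalue[OF P_sym] by blast
    \<comment> \<open>The zero rows of \<open>?P\<close> give \<open>k * e $ j = 0\<close>, and
      \<open>k\<close> is nonzero.\<close>
    have e0: "e $ j = 0" if "xs $ j = 0" for j
      using P_zero[OF that, of e] k by (simp add: Pe)
    define v where "v = stack (e, 0 :: real ^ 'n)"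
    have v: "fst (unstack v) = e" "v $ Inr j = 0" "v $ Inl i = e $ i" for i j
      by (simp_all add: v_def stack_nth)
    define x where "x = 1 - alpha / beta * k"
    have "(?J *v v) $ m = (x *\<^sub>R v) $ m" for m
    proof (cases m)
      case (Inl i)
      then show ?thesis
        using J_Inl[of v i] v e0 by (simp add: Pe x_def algebra_simps)
    qed (simp add: J_Inr v)
    then have "?J *v v = x *\<^sub>R v" by (simp add: vec_eq_iff)
    moreover have "v \<noteq> 0"
      using \<open>e \<noteq> 0\<close> v(3) by (metis vec_eq_iff zero_index)
    ultimately have "complex_eigenvalue ?J (complex_of_real x)"
      unfolding complex_eigenvalue_components by (intro exI[of _ v] exI[of _ 0]) simp
    moreover have "x > 1"
      using k \<open>0 < alpha\<close> \<open>beta > 0\<close> by (simp add: x_def mult_pos_neg divide_neg_pos)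
    ultimately show "\<exists>e. complex_eigenvalue ?J e \<and> 1 < cmod e"
      by (intro exI[of _ "complex_of_real x"]) simp
  next
    assume "\<exists>e. complex_eigenvalue ?J e \<and> 1 < cmod e"
    then obtain z a b where z: "1 < cmod z" and "a \<noteq> 0 \<or> b \<noteq> 0"
      and Ja: "?J *v a = Re z *\<^sub>R a - Im z *\<^sub>R b" and Jb: "?J *v b = Re z *\<^sub>R b + Im z *\<^sub>R a"
      unfolding complex_eigenvalue_components by blast
    \<comment> \<open>If the Jacobian merely scales coordinate \<open>m\<close> by \<open>s\<close>
      in (0, 1), then \<open>(s - z) * (a $ m + i * b $ m) = 0\<close>, and
      \<open>z \<noteq> s\<close> because \<open>cmod z > 1\<close>.\<close>
    have vanish: "a $ m = 0 \<and> b $ m = 0"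
      if "(?J *v a) $ m = s * a $ m" "(?J *v b) $ m = s * b $ m" "0 < s" "s < 1" for m s
    proof -
      have "complex_of_real s * Complex (a $ m) (b $ m) = z * Complex (a $ m) (b $ m)"
        using that(1,2) Ja Jb by (simp add: complex_eq_iff algebra_simps)
      moreover have "z \<noteq> complex_of_real s" using z that(3,4) by auto
      ultimately have "Complex (a $ m) (b $ m) = 0" by auto
      then show ?thesis by (simp add: complex_eq_iff)
    qed
    have Inr0: "a $ Inr j = 0" "b $ Inr j = 0" for j
      using vanish[OF J_Inr J_Inr c] by auto
    have Inl0: "a $ Inl j = 0" "b $ Inl j = 0" if "xs $ j = 0" for j
      using vanish[OF J_Inl0[OF that] J_Inl0[OF that]] \<open>0 < alpha\<close> \<open>alpha < 1\<close> by auto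
    define p q where "p = fst (unstack a)" and "q = fst (unstack b)"
    have pq: "p $ i = a $ Inl i" "q $ i = b $ Inl i" for i
      by (simp_all add: p_def q_def unstack_nth)
    have "p \<noteq> 0 \<or> q \<noteq> 0"
    proof (rule ccontr)
      assume "\<not> (p \<noteq> 0 \<or> q \<noteq> 0)"
      then have "a $ m = 0 \<and> b $ m = 0" for m
        using Inr0 by (cases m) (simp_all flip: pq)
      then show False using \<open>a \<noteq> 0 \<or> b \<noteq> 0\<close> by (simp add: vec_eq_iff)
    qed
    define K where "K = beta / alpha"
    have K: "K > 0" "alpha / beta = inverse K" using \<open>0 < alpha\<close> \<open>beta > 0\<close> by (simp_all add: K_def)
    have Pp: "?P *v p = (K * (1 - Re z)) *\<^sub>R p + (K * Im z) *\<^sub>R q"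
    proof -
      have "inverse K * (?P *v p) $ i = (1 - Re z) * p $ i + Im z * q $ i" for i
        using J_Inl[OF Inr0(1) Inl0(1), of i] Ja by (simp add: pq K(2) p_def[symmetric] algebra_simps)
      then show ?thesis using K(1) by (simp add: vec_eq_iff field_simps)
    qed
    have Pq: "?P *v q = (K * (1 - Re z)) *\<^sub>R q - (K * Im z) *\<^sub>R p"
    proof -
      have "inverse K * (?P *v q) $ i = (1 - Re z) * q $ i - Im z * p $ i" for i
        using J_Inl[OF Inr0(2) Inl0(2), of i] Jb by (simp add: pq K(2) q_def[symmetric] algebra_simps)
      then show ?thesis using K(1) by (simp add: vec_eq_iff field_simps)
    qed
    \<comment> \<open>Symmetry equates \<open>q \<bullet> (?P *v p)\<close> with
      \<open>p \<bullet> (?P *v q)\<close>; the terms with \<open>1 - Re z\<close> cancel. This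
      shows that the eigenvalue is real.\<close>
    have "K * Im z * (p \<bullet> p + q \<bullet> q) = 0"
      using P_sym[of q p] unfolding Pp Pq
      by (simp add: inner_add_right inner_diff_right inner_commute[of p q] algebra_simps)
    moreover have "p \<bullet> p + q \<bullet> q \<noteq> 0"
      using \<open>p \<noteq> 0 \<or> q \<noteq> 0\<close> by (simp add: add_nonneg_eq_0_iff)
    ultimately have "Im z = 0" using K(1) by simp
    define k where "k = K * (1 - Re z)"
    \<comment> \<open>With \<open>Im z = 0\<close> the equations for \<open>p\<close> and
      \<open>q\<close> decouple, so whichever of them is nonzero is a real eigenvector.\<close>
    obtain d where "d \<noteq> 0" and Pd: "?P *v d = k *\<^sub>R d" and d0: "\<And>j. xs $ j = 0 \<Longrightarrow> d $ j = 0"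
    proof (cases "p = 0")
      case False
      then show ?thesis using that[of p] Pp Inl0 \<open>Im z = 0\<close> by (simp add: pq k_def)
    next
      case True
      then show ?thesis
        using that[of q] \<open>p \<noteq> 0 \<or> q \<noteq> 0\<close> Pq Inl0 \<open>Im z = 0\<close> by (simp add: pq k_def)
    qed
    have dd: "d \<bullet> d > 0" using \<open>d \<noteq> 0\<close> by simp
    \<comment> \<open>The step size condition enters here: \<open>k < 2 * K\<close> excludes
      \<open>Re z \<le> -1\<close>, so that a modulus above 1 forces \<open>Re z > 1\<close>, that
      is, negative curvature.\<close>
    have "k \<le> L" using quad_le[OF d0] dd by (simp add: Pd)
    also have "L < 2 * K"
      using \<open>beta > alpha * L / 2\<close> \<open>0 < alpha\<close> by (simp add: K_def field_simps)
    finally have "K * (1 - Re z) < K * 2" by (simp add: k_def mult.commute)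
    then have "Re z > -1" using K(1) by simp
    then have "Re z > 1" using z \<open>Im z = 0\<close> by (simp add: cmod_eq_Re)
    then have "k < 0" using K(1) by (simp add: k_def mult_pos_neg)
    then have "d \<bullet> (?P *v d) < 0" using dd by (simp add: Pd mult_neg_pos)
    then show "strict_saddle f lam r xs"
      using \<open>stationary f lam r xs\<close> d0 unfolding strict_saddle_def by blast
  qed
  moreover have "T_map f lam r alpha beta mu (xs, 0) = (xs, 0)"
    using assms cont_g by (intro T_map_fixed_point) auto
  moreover have "invertible ?J" if "alpha < beta / rho"
  proof -
    \<comment> \<open>A kernel vector vanishes on the coordinates scaled by \<open>c\<close> and by
      \<open>1 - alpha\<close>. The remaining part satisfies
      \<open>?P *v p = (beta / alpha) *\<^sub>R p\<close>, which the bound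
      \<open>rho < beta / alpha\<close> on the spectral norm permits only for
      \<open>p = 0\<close>.\<close>
    have "v = 0" if Jv: "?J *v v = 0" for v
    proof -
      have Inr0: "v $ Inr j = 0" for j
        using J_Inr[of v j] c(1) by (simp add: Jv)
      have Inl0: "v $ Inl j = 0" if "xs $ j = 0" for j
        using J_Inl0[OF that, of v] \<open>alpha < 1\<close> by (simp add: Jv)
      define p where "p = fst (unstack v)"
      have p: "p $ i = v $ Inl i" for i by (simp add: p_def unstack_nth)
      have "p $ i = alpha / beta * (?P *v p) $ i" for i
        using J_Inl[OF Inr0 Inl0, of i] by (simp add: Jv p p_def[symmetric])
      then have "(beta / alpha) *\<^sub>R p = ?P *v p"
        using \<open>0 < alpha\<close> \<open>beta > 0\<close> by (simp add: vec_eq_iff field_simps)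
      then have "beta / alpha * norm p = norm (?P *v p)"
        using \<open>0 < alpha\<close> \<open>beta > 0\<close> by (metis abs_of_pos divide_pos_pos norm_scaleR)
      also have "\<dots> \<le> spectral_norm ?P * norm p"
        unfolding spectral_norm_def by (intro onorm matrix_vector_mul_bounded_linear)
      also have "\<dots> \<le> rho * norm p"
        using assms by (intro mult_right_mono) auto
      finally have "(beta / alpha - rho) * norm p \<le> 0" by (simp add: algebra_simps)
      moreover have "beta / alpha - rho > 0"
        using \<open>alpha < beta / rho\<close> \<open>0 < alpha\<close> \<open>rho > 0\<close> by (simp add: field_simps)
      ultimately have "p = 0" by (simp add: mult_le_0_iff)
      then have "v $ m = 0" for m
        using Inr0 \<open>p = 0\<close> by (cases m) (simp_all flip: p)
      then show "v = 0" by (simp add: vec_eq_iff)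
    qed
    then show ?thesis
      unfolding invertible_left_inverse matrix_left_invertible_ker by blast
  qed
  ultimately show ?thesis unfolding unstable_fixed_point_def by blast
qed

end
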